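(* Let $p,q\ge 2$, and let $\mathcal{S}=\{S_1,\ldots,S_p\}$ and $\mathcal{T}=\{T_1,\ldots,T_q\}$, where all $S_i,T_j\subseteq\mathbb{N}$ are nonempty. Suppose the $\mathcal{S}$-limited shift $X(\mathcal{S})$ is conjugate to the $\mathcal{T}$-limited shift $X(\mathcal{T})$. Then for all $l\in\mathbb{N}$, $$\left|\{x\in G_{\mathcal{S}} : |x|=l\}\right|=\left|\{y\in G_{\mathcal{T}} : |y|=l\}\right| .$$
   Context: $\mathbb{N}=\{1,2,3,\ldots\}$. For an indexed family $\mathcal{S}=\{S_1,\ldots,S_p\}$ of subsets of $\mathbb{N}$ (repetitions allowed), the core set is $G_{\mathcal{S}}=\{1^{m_1}2^{m_2}\cdots p^{m_p} : m_i\in S_i \text{ for } 1\le i\le p\}$, a set of finite words over $\mathcal{A}=\{1,\ldots,p\}$, where $a^m$ is the letter $a$ repeated $m$ times. The $\mathcal{S}$-limited shift is the subshift $X(\mathcal{S})\subseteq\mathcal{A}^{\mathbb{Z}}$ given by the closure (in the product topology) of the set of all bi-infinite concatenations $\cdots x_{-1}x_0x_1\cdots$ with $x_i\in G_{\mathcal{S}}$ for all $i\in\mathbb{Z}$ (with the origin placed at any coordinate, so the set is shift-invariant). $G_{\mathcal{T}}$ and $X(\mathcal{T})$ are defined in the same way over $\{1,\ldots,q\}$. $|x|$ denotes the length of a word $x$. Two subshifts $X,Y$ are conjugate if there is a homeomorphism $\varphi:X\to Y$ with $\varphi\circ\sigma=\sigma\circ\varphi$, where $\sigma$ is the shift map.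 *)

theory Defs
  imports "HOL-Analysis.Analysis"
begin

text \<open>
  A family indexed by \<open>1, \<dots>, p\<close> is a function \<open>S :: nat \<Rightarrow> nat set\<close>, of which only the values at
  \<open>1, \<dots>, p\<close> are used.  Words over \<open>{1, \<dots>, p}\<close> are lists of naturals.
\<close>

definition core_set :: "nat \<Rightarrow> (nat \<Rightarrow> nat set) \<Rightarrow> nat list set" where
  "core_set p S =
     {concat (map (\<lambda>i. replicate (m i) i) [1..<Suc p]) | m. \<forall>i\<in>{1..p}. m i \<in> S i}"

text \<open>
  \<open>x\<close> is a concatenation \<open>\<dots> w\<^bsub>-1\<^esub> w\<^bsub>0\<^esub> w\<^bsub>1\<^esub> \<dots>\<close> of words from \<open>G\<close>, where \<open>c i\<close> is the coordinate at which
  \<open>w i\<close> starts; \<open>c 0\<close> is arbitrary.  The blocks exhaust all coordinates provided that \<open>G\<close> does not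
  contain the empty word, which holds for the core set of a nonempty family of sets of positive integers.
\<close>

definition biinfinite_concats :: "nat list set \<Rightarrow> (int \<Rightarrow> nat) set" where
  "biinfinite_concats G =
     {x. \<exists>(w :: int \<Rightarrow> nat list) (c :: int \<Rightarrow> int).
           \<forall>i. w i \<in> G \<and> c (i + 1) = c i + int (length (w i)) \<and>
               (\<forall>j<length (w i). x (c i + int j) = w i ! j)}"

text \<open>
  The function space \<open>int \<Rightarrow> nat\<close> carries the product of discrete topologies, and \<open>{1, \<dots>, p}\<close>-valued
  functions form a closed subspace of it, so the closure below agrees with the one taken in that subspace.
\<close>

definition limited_shift :: "nat \<Rightarrow> (nat \<Rightarrow> nat set) \<Rightarrow> (int \<Rightarrow> nat) set" where
  "limited_shift p S = closure (biinfinite_concats (core_set p S))"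

definition shift_map :: "(int \<Rightarrow> 'a) \<Rightarrow> int \<Rightarrow> 'a" where
  "shift_map x = (\<lambda>n. x (n + 1))"

definition conjugate_shifts ::
  "(int \<Rightarrow> 'a::topological_space) set \<Rightarrow> (int \<Rightarrow> 'b::topological_space) set \<Rightarrow> bool" where
  "conjugate_shifts X Y \<longleftrightarrow>
     (\<exists>\<phi> \<psi>. homeomorphism X Y \<phi> \<psi> \<and> (\<forall>x\<in>X. \<phi> (shift_map x) = shift_map (\<phi> x)))"

end

theory Submission
  imports Defs
begin

text \<open>
  Core words are nondecreasing and every word ends with a letter larger than the first letter of
  its successor, so the cuts of a concatenation are exactly its descents.  A periodic point of the
  closure that is not constant has a descent in every period, hence is a concatenation itself.
  Coding such a point of period \<open>n\<close> by the block covering the origin, the position of the origin in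
  this block, and the remaining blocks of one period shows that their number is
  \<open>\<Sum>l=1..n. l * c\<^sub>l * a\<^bsub>n-l\<^esub>\<close>, where \<open>c\<^sub>l\<close> counts the core words of length \<open>l\<close> and \<open>a\<^sub>m\<close> the sequences of
  core words of total length \<open>m\<close>.  The number is a conjugacy invariant, and since \<open>a\<^sub>m\<close> depends only on
  \<open>c\<^sub>1, \<dots>, c\<^sub>m\<close>, it determines \<open>c\<^sub>n\<close> recursively.
\<close>

section \<open>Shift-invariant closures\<close>

text \<open>Prescribing finitely many coordinates is an open condition in a product of discrete
  spaces. It lets a point of the closure be compared with a genuine concatenation on a finite
  window.\<close>

lemma closure_agrees_on_finite:
  fixes x :: "'i \<Rightarrow> 'a::discrete_topology"
  assumes "x \<in> closure A" and "finite I"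
  obtains y where "y \<in> A" and "\<And>i. i \<in> I \<Longrightarrow> y i = x i"
proof -
  let ?U = "{f. \<forall>i\<in>I. f i \<in> {x i}}"
  have "open ?U"
    using product_topology_basis'[of I "\<lambda>i. {x i}" id] assms(2) by (simp add: open_discrete)
  moreover have "x \<in> ?U" by simp
  ultimately have "A \<inter> ?U \<noteq> {}"
    using assms(1) by (meson IntI empty_iff open_Int_closure_eq_empty inf_commute closure_iff_nhds_not_empty subset_refl)
  then show thesis using that by blast
qed

lemma funpow_shift_map: "(shift_map ^^ n) x = (\<lambda>k. x (k + int n))"
  by (induction n) (auto simp: shift_map_def algebra_simps)

lemma shift_map_closure:
  fixes A :: "(int \<Rightarrow> 'a::topological_space) set"
  assumes "shift_map ` A \<subseteq> A"
  shows "shift_map ` closure A \<subseteq> closure A"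
proof -
  have "continuous_on UNIV (shift_map :: (int \<Rightarrow> 'a) \<Rightarrow> _)"
    unfolding shift_map_def
    by (intro continuous_on_coordinatewise_then_product continuous_on_product_coordinates)
  then have "continuous_on (closure A) (shift_map :: (int \<Rightarrow> 'a) \<Rightarrow> _)"
    using continuous_on_subset by blast
  then show ?thesis
    by (rule image_closure_subset) (use assms closure_subset in auto)
qed

lemma shift_map_biinfinite_concats: "shift_map ` biinfinite_concats G \<subseteq> biinfinite_concats G"
proof
  fix y assume "y \<in> shift_map ` biinfinite_concats G"
  then obtain x where y: "y = shift_map x" and "x \<in> biinfinite_concats G" by blast
  then obtain w :: "int \<Rightarrow> nat list" and c where "\<forall>i. w i \<in> G \<and> c (i + 1) = c i + int (length (w i)) \<and>
               (\<forall>j<length (w i). x (c i + int j) = w i ! j)"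
    unfolding biinfinite_concats_def by blast
  then show "y \<in> biinfinite_concats G"
    unfolding biinfinite_concats_def
    by (auto simp: y shift_map_def intro!: exI[of _ w] exI[of _ "\<lambda>i. c i - 1"])
qed

text \<open>A limited shift can contain constant points that are limits of ever longer runs of one
  letter but not concatenations. Removing the fixed points discards them and still gives a conjugacy
  invariant. The period \<open>n\<close> need not be the least one.\<close>

definition periodic_nonfixed :: "(int \<Rightarrow> 'a) set \<Rightarrow> nat \<Rightarrow> (int \<Rightarrow> 'a) set" where
  "periodic_nonfixed X n = {x \<in> X. (shift_map ^^ n) x = x \<and> shift_map x \<noteq> x}"

lemma card_periodic_nonfixed_conjugate:
  assumes "conjugate_shifts X Y" and "shift_map ` X \<subseteq> X"
  shows "card (periodic_nonfixed X n) = card (periodic_nonfixed Y n)"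
proof -
  obtain \<phi> \<psi> where hom: "homeomorphism X Y \<phi> \<psi>"
    and comm: "\<And>x. x \<in> X \<Longrightarrow> \<phi> (shift_map x) = shift_map (\<phi> x)"
    using assms(1) unfolding conjugate_shifts_def by auto
  have inj: "inj_on \<phi> X" by (rule inj_on_inverseI) (rule homeomorphism_apply1[OF hom])
  have img: "\<phi> ` X = Y" using hom by (simp add: homeomorphism_image1)
  have iter: "(shift_map ^^ m) x \<in> X \<and> \<phi> ((shift_map ^^ m) x) = (shift_map ^^ m) (\<phi> x)"
    if "x \<in> X" for x m
  proof (induction m)
    case (Suc m)
    then show ?case using assms(2) comm[of "(shift_map ^^ m) x"] by auto
  qed (use that in simp)
  \<comment> \<open>Used with \<open>m = n\<close> for periodicity and with \<open>m = 1\<close> for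
    being fixed.\<close>
  have fixes_iff: "(shift_map ^^ m) (\<phi> x) = \<phi> x \<longleftrightarrow> (shift_map ^^ m) x = x" if "x \<in> X" for x m
    using iter[OF that, of m] inj_on_eq_iff[OF inj, of "(shift_map ^^ m) x" x] that by metis
  have "\<phi> x \<in> periodic_nonfixed Y n \<longleftrightarrow> x \<in> periodic_nonfixed X n" if "x \<in> X" for x
    using fixes_iff[OF that, of n] fixes_iff[OF that, of 1] that img
    by (simp add: periodic_nonfixed_def image_iff) blast
  then have "\<phi> ` periodic_nonfixed X n = periodic_nonfixed Y n"
    using img by (fastforce simp: periodic_nonfixed_def)
  then have "bij_betw \<phi> (periodic_nonfixed X n) (periodic_nonfixed Y n)"
    unfolding bij_betw_def using inj by (auto simp: periodic_nonfixed_def inj_on_def)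
  then show ?thesis by (rule bij_betw_same_card)
qed

section \<open>Factorizations into words of a code\<close>

definition words_of_length :: "'a list set \<Rightarrow> nat \<Rightarrow> 'a list set" where
  "words_of_length G l = {w \<in> G. length w = l}"

definition factorizations :: "'a list set \<Rightarrow> nat \<Rightarrow> 'a list list set" where
  "factorizations G n = {ws. set ws \<subseteq> G \<and> length (concat ws) = n}"

lemma factorizations_0:
  assumes "[] \<notin> G"
  shows "factorizations G 0 = {[]}"
proof -
  have "ws = []" if "set ws \<subseteq> G" "concat ws = []" for ws
    using that assms by (cases ws) auto
  then show ?thesis by (auto simp: factorizations_def)
qed

text \<open>Split off the first word: \<open>n > 0\<close> excludes the empty list, and the absence
  of the empty word gives the first word length at least 1.\<close>

lemma bij_betw_factorizations:
  assumes "[] \<notin> G" and "n > 0"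
  shows "bij_betw (\<lambda>(l, w, ws). w # ws)
           (SIGMA l:{1..n}. words_of_length G l \<times> factorizations G (n - l)) (factorizations G n)"
proof -
  have "ws \<in> (\<lambda>(l, w, ws). w # ws) `
      (SIGMA l:{1..n}. words_of_length G l \<times> factorizations G (n - l))"
    if "ws \<in> factorizations G n" for ws
  proof (cases ws)
    case Nil
    then show ?thesis using that assms by (auto simp: factorizations_def)
  next
    case (Cons v vs)
    moreover have "v \<noteq> []" using that assms Cons by (auto simp: factorizations_def)
    ultimately show ?thesis using that
      by (intro image_eqI[of _ _ "(length v, v, vs)"])
        (auto simp: factorizations_def words_of_length_def Suc_le_eq)
  qed
  then show ?thesis
    unfolding bij_betw_def
    by (auto simp: inj_on_def) (auto simp: factorizations_def words_of_length_def)
qed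

lemma finite_factorizations:
  assumes "[] \<notin> G" and "\<And>l. finite (words_of_length G l)"
  shows "finite (factorizations G n)"
proof (induction n rule: less_induct)
  case (less n)
  show ?case
  proof (cases "n = 0")
    case True
    then show ?thesis by (simp add: factorizations_0[OF assms(1)])
  next
    case False
    then show ?thesis
      using bij_betw_finite[OF bij_betw_factorizations[OF assms(1), of n]] assms(2) less by auto
  qed
qed

lemma card_factorizations:
  assumes "[] \<notin> G" and "\<And>l. finite (words_of_length G l)" and "n > 0"
  shows "card (factorizations G n)
    = (\<Sum>l=1..n. card (words_of_length G l) * card (factorizations G (n - l)))"
  using bij_betw_same_card[OF bij_betw_factorizations[OF assms(1,3)]]
  by (simp add: card_cartesian_product finite_factorizations assms)

text \<open>In the recursion of \<open>card_factorizations\<close>, \<open>l\<close> starts at 1, so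
  only factorization counts of total length below \<open>n\<close> and word counts up to
  \<open>n\<close> enter.\<close>

lemma card_factorizations_cong:
  assumes "[] \<notin> G" and "\<And>l. finite (words_of_length G l)"
    and "[] \<notin> H" and "\<And>l. finite (words_of_length H l)"
    and "\<And>l. l \<le> n \<Longrightarrow> card (words_of_length G l) = card (words_of_length H l)"
  shows "card (factorizations G n) = card (factorizations H n)"
  using assms(5)
proof (induction n rule: less_induct)
  case (less n)
  show ?case
  proof (cases "n = 0")
    case True
    then show ?thesis by (simp add: factorizations_0 assms)
  next
    case False
    then have "card (factorizations G n)
      = (\<Sum>l=1..n. card (words_of_length G l) * card (factorizations G (n - l)))"
      using assms by (simp add: card_factorizations)
    also have "\<dots> = (\<Sum>l=1..n. card (words_of_length H l) * card (factorizations H (n - l)))"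
      using less by (intro sum.cong refl arg_cong2[of _ _ _ _ times]) auto
    finally show ?thesis using False assms by (simp add: card_factorizations)
  qed
qed

section \<open>Codes cut at descents\<close>

text \<open>Sortedness forbids descents inside a word; comparing last and first letters over all
  pairs, \<open>v = w\<close> included, forces one at every junction. Finiteness makes each
  \<open>card\<close> a true count.\<close>

locale descent_code =
  fixes G :: "nat list set"
  assumes Nil_notin: "[] \<notin> G"
    and sorted: "w \<in> G \<Longrightarrow> sorted w"
    and hd_less_last: "v \<in> G \<Longrightarrow> w \<in> G \<Longrightarrow> hd w < last v"
    and finite_words: "finite (words_of_length G l)"
begin

lemma length_pos: "w \<in> G \<Longrightarrow> 0 < length w"
  using Nil_notin by auto

text \<open>If the first words had different lengths, the end of the shorter one would be a
  junction, hence a descent, inside the longer one, which is sorted. So the first words agree and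
  can be cancelled.\<close>

lemma unique_factorization:
  assumes "set vs \<subseteq> G" and "set ws \<subseteq> G" and "concat vs = concat ws"
  shows "vs = ws"
proof -
  have not_shorter: "\<not> length v < length w"
    if "v \<in> G" "w \<in> G" "set vs \<subseteq> G" "v @ concat vs = w @ concat ws" for v w vs ws
  proof
    assume lt: "length v < length w"
    then have "vs \<noteq> []" using that(4) by (metis append_Nil2 concat.simps(1) length_append not_add_less1)
    then obtain u us where vs: "vs = u # us" by (cases vs) auto
    have u: "u \<in> G" "u \<noteq> []" and v: "v \<noteq> []" using that vs Nil_notin by auto
    have "w ! length v = (v @ concat vs) ! length v"
      using lt that(4) by (simp add: nth_append)
    also have "\<dots> = hd u" using u vs by (simp add: nth_append hd_conv_nth)
    finally have 1: "w ! length v = hd u" .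
    have "w ! (length v - 1) = (v @ concat vs) ! (length v - 1)"
      using lt that(4) by (metis less_imp_diff_less nth_append)
    also have "\<dots> = last v" using v by (simp add: nth_append last_conv_nth)
    finally have "last v \<le> hd u"
      using sorted_nth_mono[OF sorted[OF that(2)], of "length v - 1" "length v"] lt 1 by simp
    then show False using hd_less_last[OF that(1) u(1)] by simp
  qed
  show ?thesis using assms
  proof (induction vs arbitrary: ws)
    case Nil
    then show ?case using Nil_notin by (cases ws) auto
  next
    case (Cons v vs)
    then obtain w ws' where ws: "ws = w # ws'" using Nil_notin by (cases ws) auto
    have G: "v \<in> G" "w \<in> G" "set vs \<subseteq> G" "set ws' \<subseteq> G"
      and eq: "v @ concat vs = w @ concat ws'"
      using Cons.prems ws by auto
    have "length v = length w"
      using not_shorter[OF G(1,2,3) eq] not_shorter[OF G(2,1,4) eq[symmetric]] by linarith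
    with eq have "v = w" "concat vs = concat ws'" by auto
    then show ?case using Cons.IH[OF G(3,4)] ws by simp
  qed
qed

text \<open>The concatenation inherits a descent across its cyclic seam, so its periodic repetition
  also descends where one copy meets the next.\<close>

lemma factorization_ends:
  assumes "set ws \<subseteq> G" and "w \<in> G"
  shows "last (concat (w # ws)) > hd w" and "hd (concat (w # ws)) = hd w"
proof -
  have "\<exists>v\<in>G. last (concat (w # ws)) = last v"
    using assms
  proof (induction ws arbitrary: w)
    case (Cons v ws)
    then have "concat (v # ws) \<noteq> []" using Nil_notin by auto
    then show ?case using Cons by (auto simp: last_append)
  qed auto
  then show "last (concat (w # ws)) > hd w" using hd_less_last assms by fastforce
  show "hd (concat (w # ws)) = hd w" using assms Nil_notin by (cases w) auto
qed

end

section \<open>Periodic points as cyclic factorizations\<close>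

text \<open>The bi-infinite repetition of \<open>u\<close>, placed so that one copy starts at
  coordinate \<open>- j\<close>; for \<open>j < length u\<close> the origin is at position
  \<open>j\<close> of that copy.\<close>

definition periodic_word :: "'a list \<Rightarrow> nat \<Rightarrow> int \<Rightarrow> 'a" where
  "periodic_word u j k = u ! nat ((k + int j) mod int (length u))"

lemma periodic_word_shift:
  "periodic_word u j (k + int (length u)) = periodic_word u j k"
  unfolding periodic_word_def by (metis (no_types) add.assoc add.commute mod_add_self2)

lemma periodic_word_nth:
  "t < length u \<Longrightarrow> periodic_word u j (int t - int j) = u ! t"
  unfolding periodic_word_def by simp

lemma periodic_word_last:
  "u \<noteq> [] \<Longrightarrow> periodic_word u j (- int j - 1) = last u"
proof -
  assume u: "u \<noteq> []"
  have "periodic_word u j (- int j - 1) = periodic_word u j (int (length u - 1) - int j)"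
    using periodic_word_shift[of u j "- int j - 1"] u by (simp add: algebra_simps of_nat_diff Suc_le_eq)
  then show ?thesis using u periodic_word_nth[of "length u - 1" u j] by (simp add: last_conv_nth)
qed

lemma periodic_word_in_biinfinite_concats:
  assumes "set ws \<subseteq> G" and "ws \<noteq> []" and "[] \<notin> G"
  shows "periodic_word (concat ws) j \<in> biinfinite_concats G"
proof -
  define r where "r = int (length ws)"
  define n where "n = int (length (concat ws))"
  define s where "s t = length (concat (take t ws))" for t
  define w where "w i = ws ! nat (i mod r)" for i
  \<comment> \<open>Block \<open>i\<close> is word \<open>i mod r\<close> in copy number
    \<open>i div r\<close>: its start is the length of the words before it in the copy, plus
    \<open>n\<close> per copy, minus \<open>j\<close> for the origin.\<close>
  define c where "c i = int (s (nat (i mod r))) + (i div r) * n - int j" for i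
  have r: "r > 0" using assms(2) by (simp add: r_def)
  have idx: "nat (i mod r) < length ws" for i
    using r pos_mod_bound[of r i] pos_mod_sign[of r i] by (simp add: r_def nat_less_iff)
  have s_Suc: "s (Suc t) = s t + length (ws ! t)" if "t < length ws" for t
    using that by (simp add: s_def take_Suc_conv_app_nth)
  have "w i \<in> G" for i using idx[of i] assms(1) by (auto simp: w_def)
  moreover have "c (i + 1) = c i + int (length (w i))" for i
  \<comment> \<open>After the last word of a copy the index wraps around: the prefix length drops to
    0 and the quotient grows by one.\<close>
  proof (cases "i mod r = r - 1")
    case True
    then have i: "i + 1 = (i div r + 1) * r"
      using div_mult_mod_eq[of i r] unfolding distrib_right by linarith
    have "(i + 1) mod r = 0" "(i + 1) div r = i div r + 1" using i r by simp_all
    moreover have "int (s (nat (i mod r))) + int (length (w i)) = n"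
      using s_Suc[OF idx[of i]] True r by (simp add: w_def n_def s_def r_def nat_diff_distrib)
    ultimately show ?thesis by (simp add: c_def s_def algebra_simps)
  next
    case False
    then have lt: "i mod r + 1 < r" using pos_mod_bound[of r i] r by linarith
    have i: "i + 1 = r * (i div r) + (i mod r + 1)" by simp
    have "(i + 1) mod r = i mod r + 1" "(i + 1) div r = i div r"
      using int_mod_pos_eq[OF i _ lt] int_div_pos_eq[OF i _ lt] r by simp_all
    moreover have "s (nat (i mod r + 1)) = s (nat (i mod r)) + length (w i)"
      using s_Suc[OF idx[of i]] r pos_mod_sign[of r i] by (simp add: w_def nat_add_distrib)
    ultimately show ?thesis by (simp add: c_def)
  qed
  moreover have "periodic_word (concat ws) j (c i + int t) = w i ! t" if "t < length (w i)" for i t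
  proof -
    let ?m = "nat (i mod r)"
    have split: "concat ws = concat (take ?m ws) @ w i @ concat (drop (Suc ?m) ws)"
      using id_take_nth_drop[OF idx[of i]] by (metis concat.simps(2) concat_append w_def)
    then have len: "length (concat ws) = s ?m + length (w i) + length (concat (drop (Suc ?m) ws))"
      by (metis length_append s_def add.assoc)
    have "c i + int t + int j = int (s ?m + t) + (i div r) * n" by (simp add: c_def)
    then have "(c i + int t + int j) mod n = int (s ?m + t) mod n"
      by (metis mod_mult_self1)
    also have "\<dots> = int (s ?m + t)" using len that by (simp add: n_def)
    finally have "periodic_word (concat ws) j (c i + int t) = concat ws ! (s ?m + t)"
      unfolding periodic_word_def n_def by (metis nat_int)
    also have "\<dots> = w i ! t" using that by (subst split) (simp add: s_def nth_append)
    finally show ?thesis .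
  qed
  ultimately show ?thesis unfolding biinfinite_concats_def by blast
qed

section \<open>Cuts, windows and descents of sequences indexed by the integers\<close>

lemma strict_mono_tight_interval:
  fixes c :: "int \<Rightarrow> int"
  assumes "\<And>i. c i < c (i + 1)"
  obtains i where "c i \<le> k" and "k < c (i + 1)"
proof -
  have up: "c i + int m \<le> c (i + int m)" for i m
  proof (induction m)
    case (Suc m)
    then show ?case using assms[of "i + int m"] by (simp add: algebra_simps)
  qed simp
  \<comment> \<open>Each step raises \<open>c\<close> by at least 1, so \<open>N\<close> steps to
    the left of index 0 the value is at most \<open>k\<close>. The first later index whose value
    exceeds \<open>k\<close> ends the required interval.\<close>
  define N where "N = nat (c 0 - k)"
  let ?a = "- int N"
  have "c 0 - k \<le> int N" by (simp add: N_def)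
  then have a: "c ?a \<le> k" using up[of ?a N] by simp
  let ?P = "\<lambda>m. k < c (?a + int m)"
  have ex: "?P (nat (k - c ?a + 1))" using up[of ?a "nat (k - c ?a + 1)"] a by simp
  define m where "m = (LEAST m. ?P m)"
  have m: "?P m" unfolding m_def using ex by (rule LeastI)
  with a have "m \<noteq> 0" by (metis add.right_neutral not_less of_nat_0)
  then obtain m' where m': "m = Suc m'" by (cases m) auto
  have "\<not> ?P m'" using m' not_less_Least[of m' ?P] by (simp add: m_def)
  then show thesis using m that[of "?a + int m'"] by (simp add: m' algebra_simps)
qed

definition segment :: "(int \<Rightarrow> 'a) \<Rightarrow> int \<Rightarrow> nat \<Rightarrow> 'a list" where
  "segment x a n = map (\<lambda>t. x (a + int t)) [0..<n]"

lemma length_segment [simp]: "length (segment x a n) = n"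
  by (simp add: segment_def)

lemma nth_segment [simp]: "t < n \<Longrightarrow> segment x a n ! t = x (a + int t)"
  by (simp add: segment_def)

lemma segment_add: "segment x a (m + n) = segment x a m @ segment x (a + int m) n"
  by (rule nth_equalityI) (auto simp: nth_append)

text \<open>Both claims go through one induction, because the first locates the start of the next
  word, where the second extends the window.\<close>

lemma segment_concat:
  fixes w :: "int \<Rightarrow> 'a list" and c :: "int \<Rightarrow> int"
  assumes "\<And>i. c (i + 1) = c i + int (length (w i))"
    and "\<And>i j. j < length (w i) \<Longrightarrow> x (c i + int j) = w i ! j"
  shows "c (a + int m) = c a + int (length (concat (map (\<lambda>s. w (a + int s)) [0..<m])))
    \<and> segment x (c a) (length (concat (map (\<lambda>s. w (a + int s)) [0..<m])))
        = concat (map (\<lambda>s. w (a + int s)) [0..<m])"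
proof (induction m)
  case 0
  then show ?case by (simp add: segment_def)
next
  case (Suc m)
  have "segment x (c (a + int m)) (length (w (a + int m))) = w (a + int m)"
    using assms(2) by (intro nth_equalityI) auto
  moreover have "c (a + int (Suc m)) = c (a + int m) + int (length (w (a + int m)))"
    using assms(1)[of "a + int m"] by (simp add: ac_simps)
  ultimately show ?case using Suc by (simp add: segment_add del: of_nat_Suc)
qed

lemma periodic_int:
  fixes x :: "int \<Rightarrow> 'a" and n :: int
  assumes "\<And>k. x (k + n) = x k"
  shows "x (k + i * n) = x k"
proof (induction i rule: int_induct[where k = 0])
  case (step1 i)
  then show ?case using assms[of "k + i * n"] by (simp add: algebra_simps)
next
  case (step2 i)
  then show ?case using assms[of "k + (i - 1) * n"] by (simp add: algebra_simps)
qed simp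

text \<open>A periodic sequence without descents is nondecreasing, hence constant. Otherwise some
  descent has a translate among the last \<open>n\<close> coordinates up to 0; the largest descent
  there will be the start of the block covering the origin.\<close>

lemma periodic_last_descent:
  fixes x :: "int \<Rightarrow> 'a::linorder"
  assumes per: "\<And>k. x (k + int n) = x k" and "n > 0" and "x (k + 1) \<noteq> x k"
  obtains d where "- int n < d" and "d \<le> 0" and "x d < x (d - 1)"
    and "\<And>e. d < e \<Longrightarrow> e \<le> 0 \<Longrightarrow> x (e - 1) \<le> x e"
proof -
  obtain d0 where d0: "x d0 < x (d0 - 1)"
  proof (rule ccontr)
    assume "\<not> thesis"
    then have mono1: "x e \<le> x (e + 1)" for e using that[of "e + 1"] by (cases "x (e + 1) < x e") auto
    have mono: "x a \<le> x (a + int m)" for a m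
    proof (induction m)
      case (Suc m)
      then show ?case using mono1[of "a + int m"] by (auto simp: algebra_simps intro: order_trans)
    qed simp
    have "x (k + 1) \<le> x (k + int n)"
      using mono[of "k + 1" "n - 1"] assms(2) by (simp add: of_nat_diff Suc_le_eq)
    then show False using per[of k] mono1[of k] assms(3) by simp
  qed
  let ?D = "{e. - int n < e \<and> e \<le> 0 \<and> x e < x (e - 1)}"
  \<comment> \<open>The translate of \<open>d0\<close> by a multiple of \<open>n\<close> that falls
    between \<open>- n + 1\<close> and 0.\<close>
  define d1 where "d1 = - ((- d0) mod int n)"
  have d1: "d1 = d0 + (- d0) div int n * int n"
    using div_mult_mod_eq[of "- d0" "int n"] unfolding d1_def by linarith
  have "x d1 = x d0" "x (d1 - 1) = x (d0 - 1)"
    using periodic_int[of x "int n" d0 "(- d0) div int n"]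
      periodic_int[of x "int n" "d0 - 1" "(- d0) div int n"] per
    by (simp_all add: d1 algebra_simps)
  then have ne: "d1 \<in> ?D"
    using assms(2) d0 pos_mod_bound[of "int n" "- d0"] pos_mod_sign[of "int n" "- d0"]
    by (simp add: d1_def)
  have fin: "finite ?D" by (rule finite_subset[of _ "{- int n..0}"]) auto
  obtain d where d: "d \<in> ?D" and max: "\<And>e. e \<in> ?D \<Longrightarrow> e \<le> d"
    using Max_in[OF fin] Max_ge[OF fin] ne by blast
  show thesis
  proof (rule that)
    show "x (e - 1) \<le> x e" if "d < e" "e \<le> 0" for e
      using that d max[of e] by (cases "x e < x (e - 1)") auto
  qed (use d in auto)
qed

section \<open>Cuts of a descent code and the count of its periodic points\<close>

context descent_code
begin

lemma descent_is_cut: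
  fixes w :: "int \<Rightarrow> nat list" and c :: "int \<Rightarrow> int"
  assumes w: "\<And>i. w i \<in> G"
    and c: "\<And>i. c (i + 1) = c i + int (length (w i))"
    and y: "\<And>i j. j < length (w i) \<Longrightarrow> y (c i + int j) = w i ! j"
    and "y k < y (k - 1)"
  obtains i where "k = c i"
proof -
  have "c i < c (i + 1)" for i using c[of i] length_pos[OF w[of i]] by simp
  then obtain i where i: "c i \<le> k" "k < c (i + 1)" using strict_mono_tight_interval by blast
  have "k = c i"
  proof (rule ccontr)
    assume "k \<noteq> c i"
    \<comment> \<open>\<open>t\<close> is the position of \<open>k - 1\<close> in the block
      containing \<open>k\<close>, so both coordinates lie in the same sorted word.\<close>
    define t where "t = nat (k - c i - 1)"
    have t: "k = c i + int (Suc t)" "Suc t < length (w i)"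
      using i \<open>k \<noteq> c i\<close> c[of i] by (auto simp: t_def)
    have "k - 1 = c i + int t" using t(1) by simp
    then have "y k = w i ! Suc t" "y (k - 1) = w i ! t" using t y[of "Suc t" i] y[of t i] by auto
    then show False
      using assms(4) t(2) sorted_nth_mono[OF sorted[OF w[of i]], of t "Suc t"] by simp
  qed
  then show thesis by (rule that)
qed

lemma cut_is_descent:
  fixes w :: "int \<Rightarrow> nat list" and c :: "int \<Rightarrow> int"
  assumes w: "\<And>i. w i \<in> G"
    and c: "\<And>i. c (i + 1) = c i + int (length (w i))"
    and y: "\<And>i j. j < length (w i) \<Longrightarrow> y (c i + int j) = w i ! j"
  shows "y (c i) < y (c i - 1)"
proof -
  have "y (c i) = hd (w i)"
    using y[of 0 i] length_pos[OF w[of i]] by (simp add: hd_conv_nth)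
  moreover have "c i - 1 = c (i - 1) + int (length (w (i - 1)) - 1)"
    using c[of "i - 1"] length_pos[OF w[of "i - 1"]] by (simp add: of_nat_diff Suc_le_eq)
  then have "y (c i - 1) = last (w (i - 1))"
    using y[of "length (w (i - 1)) - 1" "i - 1"] length_pos[OF w[of "i - 1"]]
    by (simp add: last_conv_nth del: of_nat_diff)
  ultimately show ?thesis using hd_less_last w by simp
qed

text \<open>A concatenation \<open>y\<close> agreeing with \<open>x\<close> around one period
  suffices: the descents of \<open>x\<close> at \<open>d\<close> and \<open>d + n\<close> become
  cuts of \<open>y\<close>, and the words between them spell one period of \<open>x\<close>.\<close>

lemma periodic_point_factorization:
  assumes x: "x \<in> periodic_nonfixed (closure (biinfinite_concats G)) n" and n: "n > 0"
  obtains w ws j where "w \<in> G" and "set ws \<subseteq> G" and "length (concat (w # ws)) = n"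
    and "j < length w" and "x = periodic_word (concat (w # ws)) j"
proof -
  have per: "x (k + int n) = x k" for k
    using x by (simp add: periodic_nonfixed_def funpow_shift_map fun_eq_iff)
  obtain k where "x (k + 1) \<noteq> x k"
    using x by (auto simp: periodic_nonfixed_def shift_map_def fun_eq_iff)
  then obtain d where d: "- int n < d" "d \<le> 0" "x d < x (d - 1)"
    and dmax: "\<And>e. d < e \<Longrightarrow> e \<le> 0 \<Longrightarrow> x (e - 1) \<le> x e"
    using periodic_last_descent[of x n k] per n by blast
  \<comment> \<open>The window contains both coordinates of each of the two descents, hence its
    start at \<open>d - 1\<close>.\<close>
  obtain y where "y \<in> biinfinite_concats G" and y_x: "\<And>k. k \<in> {d - 1..d + int n} \<Longrightarrow> y k = x k"
    using closure_agrees_on_finite[of x "biinfinite_concats G" "{d - 1..d + int n}"] x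
    by (auto simp: periodic_nonfixed_def)
  then obtain w :: "int \<Rightarrow> nat list" and c where w: "\<And>i. w i \<in> G"
    and c: "\<And>i. c (i + 1) = c i + int (length (w i))"
    and y: "\<And>i j. j < length (w i) \<Longrightarrow> y (c i + int j) = w i ! j"
    unfolding biinfinite_concats_def by blast
  note cut = descent_is_cut[where w = w and c = c and y = y, OF w c y]
  note descent = cut_is_descent[where w = w and c = c and y = y, OF w c y]
  have "y d < y (d - 1)" using d n y_x by simp
  then obtain a where a: "d = c a" using cut by blast
  have "y (d + int n) < y (d + int n - 1)"
    using d n y_x per[of d] per[of "d - 1"] by (simp add: algebra_simps)
  then obtain b where b: "d + int n = c b" using cut by blast
  have smono: "c i < c (i + 1)" for i using c[of i] length_pos[OF w[of i]] by simp
  have mono: "c i \<le> c (i + int m)" for i m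
  proof (induction m)
    case (Suc m)
    then show ?case using smono[of "i + int m"] by (simp add: algebra_simps)
  qed simp
  have "a < b" using mono[of b "nat (a - b)"] a b n by (cases "a < b") auto
  define m where "m = nat (b - a - 1)"
  have m: "b = a + int (Suc m)" using \<open>a < b\<close> by (simp add: m_def)
  define ws where "ws = map (\<lambda>s. w (a + int s)) [1..<Suc m]"
  have all: "map (\<lambda>s. w (a + int s)) [0..<Suc m] = w a # ws"
    unfolding ws_def by (subst upt_conv_Cons) auto
  note seg = segment_concat[where w = w and c = c and x = y and a = a and m = "Suc m", OF c y,
    unfolded all, folded m]
  have len: "length (concat (w a # ws)) = n" using seg a b by simp
  then have u: "concat (w a # ws) = segment y d n" using seg a by simp
  define j where "j = nat (- d)"
  have j: "d = - int j" using d by (simp add: j_def)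
  \<comment> \<open>The next cut lies in the window, so it is a descent of \<open>x\<close> to the
    right of \<open>d\<close>. By the choice of \<open>d\<close> it lies beyond 0, so the word
    starting at \<open>d\<close> covers the origin.\<close>
  have "c (a + 1) \<le> d + int n"
    using mono[of "a + 1" m] m b by (simp add: algebra_simps)
  then have "y (c (a + 1)) = x (c (a + 1))" "y (c (a + 1) - 1) = x (c (a + 1) - 1)"
    using y_x smono[of a] a by auto
  then have "c (a + 1) > 0"
    using descent[of "a + 1"] dmax[of "c (a + 1)"] smono[of a] a by force
  then have "j < length (w a)" using c[of a] a j by simp
  moreover have "x = periodic_word (concat (w a # ws)) j"
  proof
    fix k
    define t where "t = nat ((k + int j) mod int n)"
    have t: "t < n" "int t = (k + int j) mod int n" using n by (auto simp: t_def nat_less_iff)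
    \<comment> \<open>Translate \<open>k\<close> by a multiple of the period into the window, where
      \<open>x\<close> and \<open>y\<close> agree.\<close>
    have "x k = x (k + - ((k + int j) div int n) * int n)"
      by (rule periodic_int[of x "int n" k, OF per, symmetric])
    also have "k + - ((k + int j) div int n) * int n = d + int t"
      using t(2) j div_mult_mod_eq[of "k + int j" "int n"] by (simp add: algebra_simps)
    also have "x (d + int t) = segment y d n ! t" using t y_x by simp
    also have "\<dots> = periodic_word (concat (w a # ws)) j k"
      unfolding periodic_word_def len t_def u by simp
    finally show "x k = periodic_word (concat (w a # ws)) j k" .
  qed
  moreover have "set ws \<subseteq> G" using w by (auto simp: ws_def)
  ultimately show thesis using that w len by blast
qed

text \<open>If \<open>i < j\<close>, the seam of the first repetition at coordinate
  \<open>- i\<close>, a descent, would fall strictly inside the sorted word \<open>w\<close>, which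
  starts at \<open>- j\<close>.\<close>

lemma periodic_word_offset_le:
  assumes "v \<in> G" "set vs \<subseteq> G" "w \<in> G" "set ws \<subseteq> G" "j < length w"
    and eq: "periodic_word (concat (v # vs)) i = periodic_word (concat (w # ws)) j"
  shows "j \<le> i"
proof (rule ccontr)
  assume "\<not> j \<le> i"
  define t where "t = j - i - 1"
  let ?u = "concat (v # vs)"
  have t: "j = Suc t + i" using \<open>\<not> j \<le> i\<close> by (simp add: t_def)
  have lt: "Suc t < length w" using assms(5) t by simp
  have u: "?u \<noteq> []" using assms(1) Nil_notin by auto
  have "hd ?u = periodic_word ?u i (- int i)"
    using periodic_word_nth[of 0 ?u i] u by (simp add: hd_conv_nth)
  also have "\<dots> = w ! Suc t"
    using periodic_word_nth[of "Suc t" "concat (w # ws)" j] lt t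
    unfolding eq by (simp add: nth_append)
  finally have 1: "hd ?u = w ! Suc t" .
  have "last ?u = periodic_word ?u i (- int i - 1)"
    using periodic_word_last[of ?u i] u by simp
  also have "- int i - 1 = int t - int j" using t by simp
  also have "periodic_word ?u i (int t - int j) = w ! t"
    using periodic_word_nth[of t "concat (w # ws)" j] lt
    unfolding eq by (simp add: nth_append)
  finally have "last ?u \<le> hd ?u"
    using 1 sorted_nth_mono[OF sorted[OF assms(3)], of t "Suc t"] lt by simp
  then show False using factorization_ends[OF assms(2,1)] by simp
qed

text \<open>Comparing offsets in both directions gives \<open>i = j\<close>. The two period words
  then agree letter by letter, and unique factorization finishes.\<close>

lemma periodic_word_inj:
  assumes "v \<in> G" "set vs \<subseteq> G" "i < length v" and "w \<in> G" "set ws \<subseteq> G" "j < length w"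
    and len: "length (concat (v # vs)) = length (concat (w # ws))"
    and eq: "periodic_word (concat (v # vs)) i = periodic_word (concat (w # ws)) j"
  shows "v = w \<and> vs = ws \<and> i = j"
proof -
  have "i = j"
    using periodic_word_offset_le[OF assms(1,2,4,5,6) eq]
      periodic_word_offset_le[OF assms(4,5,1,2,3) eq[symmetric]] by simp
  moreover have "concat (v # vs) = concat (w # ws)"
    using len
  proof (rule nth_equalityI)
    fix t assume "t < length (concat (v # vs))"
    then show "concat (v # vs) ! t = concat (w # ws) ! t"
      using periodic_word_nth[of t _ i] len eq \<open>i = j\<close> by metis
  qed
  then have "v # vs = w # ws" using assms by (intro unique_factorization) auto
  ultimately show ?thesis by simp
qed

text \<open>The length \<open>l\<close> of the block covering the origin is kept as an index since
  it bounds the offset; each fibre over \<open>l\<close> is then a plain product, whose cardinality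
  is immediate.\<close>

lemma bij_betw_periodic_nonfixed:
  assumes n: "n > 0"
  shows "bij_betw (\<lambda>(l, (w, ws), j). periodic_word (concat (w # ws)) j)
    (SIGMA l:{1..n}. (words_of_length G l \<times> factorizations G (n - l)) \<times> {..<l})
    (periodic_nonfixed (closure (biinfinite_concats G)) n)"
    (is "bij_betw ?f ?A ?P")
  unfolding bij_betw_def
proof
  show "inj_on ?f ?A"
  proof (rule inj_onI)
    fix a b assume ab: "a \<in> ?A" "b \<in> ?A" "?f a = ?f b"
    obtain l v vs i where a: "a = (l, (v, vs), i)" by (metis prod.exhaust)
    obtain l' w ws j where b: "b = (l', (w, ws), j)" by (metis prod.exhaust)
    have "v = w \<and> vs = ws \<and> i = j"
      using ab unfolding a b
      by (intro periodic_word_inj) (auto simp: words_of_length_def factorizations_def)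
    then show "a = b" using ab unfolding a b by (auto simp: words_of_length_def)
  qed
  have "periodic_word (concat (w # ws)) j \<in> ?P"
    if w: "w \<in> G" "set ws \<subseteq> G" "length (concat (w # ws)) = n" for w ws j
  proof -
    let ?u = "concat (w # ws)" and ?x = "periodic_word (concat (w # ws)) j"
    have u: "?u \<noteq> []" using w Nil_notin by auto
    have "(shift_map ^^ n) ?x = ?x"
      using periodic_word_shift[of ?u j, unfolded w(3)] by (simp add: funpow_shift_map)
    \<comment> \<open>The seam at coordinate \<open>- j\<close> is a descent, so the point is not
      constant.\<close>
    moreover have "?x (- int j - 1 + 1) \<noteq> ?x (- int j - 1)"
      using periodic_word_last[OF u, of j] periodic_word_nth[of 0 ?u j] u
        factorization_ends[OF w(2,1)] by (simp add: hd_conv_nth)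
    then have "shift_map ?x \<noteq> ?x" unfolding shift_map_def by metis
    moreover have "?x \<in> biinfinite_concats G"
      using w Nil_notin by (intro periodic_word_in_biinfinite_concats) auto
    ultimately show ?thesis unfolding periodic_nonfixed_def using closure_subset by blast
  qed
  moreover have "x \<in> ?f ` ?A" if x: "x \<in> ?P" for x
  proof -
    obtain w ws j where "w \<in> G" "set ws \<subseteq> G" "length (concat (w # ws)) = n"
      "j < length w" "x = periodic_word (concat (w # ws)) j"
      using periodic_point_factorization[OF x n] .
    then show ?thesis
      by (intro image_eqI[of _ _ "(length w, (w, ws), j)"])
        (auto simp: words_of_length_def factorizations_def)
  qed
  ultimately show "?f ` ?A = ?P"
    by (auto simp: words_of_length_def factorizations_def)
qed

lemma card_periodic_nonfixed:
  assumes "n > 0"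
  shows "card (periodic_nonfixed (closure (biinfinite_concats G)) n)
    = (\<Sum>l=1..n. card (words_of_length G l) * card (factorizations G (n - l)) * l)"
  using bij_betw_same_card[OF bij_betw_periodic_nonfixed[OF assms]]
  by (simp add: card_cartesian_product finite_words finite_factorizations Nil_notin)

end

section \<open>Recovering the word counts from the periodic point counts\<close>

lemma card_words_determined:
  assumes "descent_code G" and "descent_code H"
    and eq: "\<And>n. n > 0 \<Longrightarrow> card (periodic_nonfixed (closure (biinfinite_concats G)) n)
                = card (periodic_nonfixed (closure (biinfinite_concats H)) n)"
  shows "card (words_of_length G n) = card (words_of_length H n)"
proof (induction n rule: less_induct)
  case (less n)
  interpret G: descent_code G by fact
  interpret H: descent_code H by fact
  show ?case
  proof (cases "n = 0")
    case True
    have "words_of_length G 0 = {}" "words_of_length H 0 = {}"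
      using G.Nil_notin H.Nil_notin by (auto simp: words_of_length_def)
    then show ?thesis using True by simp
  next
    case False
    let ?s = "\<lambda>K l. card (words_of_length K l) * card (factorizations K (n - l)) * l"
    have split: "(\<Sum>l=1..n. f l) = (\<Sum>l=1..<n. f l) + f n" for f :: "nat \<Rightarrow> nat"
      using False by (cases n) (auto simp: atLeastLessThanSuc_atLeastAtMost)
    \<comment> \<open>For these \<open>l\<close> both \<open>l\<close> and \<open>n - l\<close> are
      below \<open>n\<close>, so the induction hypothesis fixes both factors. What remains is the
      term \<open>l = n\<close>, which is \<open>n\<close> times the wanted count because the empty
      list is the only factorization of total length 0.\<close>
    have "?s G l = ?s H l" if "l \<in> {1..<n}" for l
      using that less
        card_factorizations_cong[OF G.Nil_notin G.finite_words H.Nil_notin H.finite_words, of "n - l"]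
      by auto
    then have "(\<Sum>l=1..<n. ?s G l) = (\<Sum>l=1..<n. ?s H l)" by (rule sum.cong[OF refl])
    moreover have "(\<Sum>l=1..n. ?s G l) = (\<Sum>l=1..n. ?s H l)"
      using eq[of n] False by (simp add: G.card_periodic_nonfixed H.card_periodic_nonfixed)
    ultimately have "?s G n = ?s H n" unfolding split by simp
    then show ?thesis
      using False by (simp add: factorizations_0 G.Nil_notin H.Nil_notin)
  qed
qed

section \<open>Core sets\<close>

lemma sorted_concat_replicate:
  "sorted is \<Longrightarrow> sorted (concat (map (\<lambda>i. replicate (m i) i) is))"
  by (induction "is") (auto simp: sorted_append)

text \<open>All exponents are positive, so peeling off the first and the last run exposes the
  letters 1 and \<open>p\<close> at the ends.\<close>

lemma core_word:
  assumes "p \<ge> 1" and S: "\<forall>i\<in>{1..p}. S i \<subseteq> {1..}" and "w \<in> core_set p S"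
  shows "w \<noteq> []" and "sorted w" and "hd w = 1" and "last w = p" and "set w \<subseteq> {1..p}"
proof -
  obtain m where w: "w = concat (map (\<lambda>i. replicate (m i) i) [1..<Suc p])"
    and m: "\<And>i. i \<in> {1..p} \<Longrightarrow> m i \<in> S i"
    using assms(3) unfolding core_set_def by blast
  have m0: "m i > 0" if "i \<in> {1..p}" for i using m[OF that] S that by fastforce
  have 1: "w = replicate (m 1) 1 @ concat (map (\<lambda>i. replicate (m i) i) [Suc 1..<Suc p])"
    unfolding w using assms(1) by (subst upt_conv_Cons) auto
  have 2: "w = concat (map (\<lambda>i. replicate (m i) i) [1..<p]) @ replicate (m p) p"
    unfolding w using assms(1) by simp
  show "w \<noteq> []" "hd w = 1" using 1 m0[of 1] assms(1) by (auto simp: hd_append)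
  show "last w = p" using 2 m0[of p] assms(1) by (auto simp: last_append)
  show "sorted w" unfolding w by (rule sorted_concat_replicate) (rule sorted_upt)
  show "set w \<subseteq> {1..p}" unfolding w by auto
qed

text \<open>Core words start with 1 and end with \<open>p\<close>, so \<open>p \<ge> 2\<close> is
  what makes every junction a strict descent. The finite alphabet bounds the number of words of each
  length.\<close>

lemma descent_code_core_set:
  assumes "p \<ge> 2" and "\<forall>i\<in>{1..p}. S i \<subseteq> {1..}"
  shows "descent_code (core_set p S)"
proof
  have p: "p \<ge> 1" using assms(1) by simp
  note cw = core_word[where p = p and S = S, OF p assms(2)]
  show "[] \<notin> core_set p S" using cw(1) by blast
  show "sorted w" if "w \<in> core_set p S" for w using cw(2)[OF that] .
  show "hd w < last v" if "v \<in> core_set p S" "w \<in> core_set p S" for v w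
    using cw(3)[OF that(2)] cw(4)[OF that(1)] assms(1) by simp
  show "finite (words_of_length (core_set p S) l)" for l
    by (rule finite_subset[OF _ finite_lists_length_eq[of "{1..p}" l]])
      (use cw(5) in \<open>auto simp: words_of_length_def\<close>)
qed

theorem theorem5p1:
  fixes p q :: nat and S T :: "nat \<Rightarrow> nat set"
  assumes "p \<ge> 2" and "q \<ge> 2"
    and "\<And>i. i \<in> {1..p} \<Longrightarrow> S i \<noteq> {} \<and> S i \<subseteq> {1..}"
    and "\<And>j. j \<in> {1..q} \<Longrightarrow> T j \<noteq> {} \<and> T j \<subseteq> {1..}"
    and "conjugate_shifts (limited_shift p S) (limited_shift q T)"
  shows "\<forall>l\<ge>1. card {x \<in> core_set p S. length x = l} = card {y \<in> core_set q T. length y = l}"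
proof -
  have "card (words_of_length (core_set p S) l) = card (words_of_length (core_set q T) l)" for l
  proof (rule card_words_determined)
    show "descent_code (core_set p S)"
      by (rule descent_code_core_set[OF assms(1)]) (use assms(3) in blast)
    show "descent_code (core_set q T)"
      by (rule descent_code_core_set[OF assms(2)]) (use assms(4) in blast)
    show "card (periodic_nonfixed (closure (biinfinite_concats (core_set p S))) n)
      = card (periodic_nonfixed (closure (biinfinite_concats (core_set q T))) n)" for n
      using card_periodic_nonfixed_conjugate[OF assms(5), of n]
        shift_map_closure[OF shift_map_biinfinite_concats]
      unfolding limited_shift_def by blast
  qed
  then show ?thesis unfolding words_of_length_def by blast
qed

end
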